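(* Suppose that either $(r_t)$ is a drifted Brownian motion $$r_t=r+\mu t+\sigma W_t,\qquad r\in\mathcal O=\mathbb R,$$ or $(r_t)$ is a geometric Brownian motion $$r_t=r\,e^{(\mu-\frac12\sigma^2)t+\sigma W_t},\qquad r\in\mathcal O=(0,\infty),$$ with constants $\mu\in\mathbb R$, $\sigma\ne0$. Then the condition $$\mathbb E^r\int_0^\infty e^{-\gamma t+\alpha\int_0^t(r_s-c)ds}dt<\infty$$ does not hold for any $c>0$ (and any $r\in\mathcal O$), and consequently the value function for Problem A is infinite: $\Phi_A(r,v)=\infty$ for all $r\in\mathcal O$, $v>0$.
   Context: $(W_t)$ is a one-dimensional Brownian motion on a filtered probability space $(\Omega,\mathcal F,(\mathcal F_t),\mathbb P)$; $\mathbb E^r=\mathbb E(\cdot\,|\,r_0=r)$; constants $\gamma\ge0$, $\alpha\in(0,1)$. $\mathcal U$ is the set of all non-negative progressively measurable processes $C=(C_t)_{t\ge0}$. For $C\in\mathcal U$, $v>0$ the wealth $V=V^{(C;r,v)}$ satisfies $dV_t=(r_tV_t-C_t)dt$, $V_0=v$; $\tau_A=\tau_A^{(C;r,v)}=\inf\{t\ge0:V_t=0\}$. Problem A is to maximize $J(C;r,v)=\mathbb E^r\int_0^{\tau_A}e^{-\gamma t}C_t^\alpha dt$ over $C\in\mathcal U$; its value function is $\Phi_A(r,v)=\sup_{C\in\mathcal U}J(C;r,v)\in[0,\infty]$. *)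

theory Defs
  imports "HOL-Probability.Probability"
begin

definition filtered_prob_space :: "'a measure \<Rightarrow> (real \<Rightarrow> 'a measure) \<Rightarrow> bool" where
  "filtered_prob_space M F \<longleftrightarrow>
     prob_space M \<and>
     (\<forall>t\<ge>0. subalgebra M (F t)) \<and>
     (\<forall>s t. 0 \<le> s \<longrightarrow> s \<le> t \<longrightarrow> subalgebra (F t) (F s))"

definition brownian_motion ::
  "'a measure \<Rightarrow> (real \<Rightarrow> 'a measure) \<Rightarrow> (real \<Rightarrow> 'a \<Rightarrow> real) \<Rightarrow> bool" where
  "brownian_motion M F W \<longleftrightarrow>
     (\<forall>t\<ge>0. W t \<in> borel_measurable (F t)) \<and>
     (\<forall>\<omega>\<in>space M. continuous_on {0..} (\<lambda>t. W t \<omega>)) \<and>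
     (AE \<omega> in M. W 0 \<omega> = 0) \<and>
     (\<forall>s t. 0 \<le> s \<longrightarrow> s < t \<longrightarrow>
        distributed M lborel (\<lambda>\<omega>. W t \<omega> - W s \<omega>)
          (\<lambda>x. ennreal (normal_density 0 (sqrt (t - s)) x)) \<and>
        prob_space.indep_set M (sets (F s))
          (sets (vimage_algebra (space M) (\<lambda>\<omega>. W t \<omega> - W s \<omega>) borel)))"

definition progressively_measurable ::
  "(real \<Rightarrow> 'a measure) \<Rightarrow> (real \<Rightarrow> 'a \<Rightarrow> real) \<Rightarrow> bool" where
  "progressively_measurable F X \<longleftrightarrow>
     (\<forall>T\<ge>0. (\<lambda>(t, \<omega>). X t \<omega>) \<in> borel_measurable (restrict_space borel {0..T} \<Otimes>\<^sub>M F T))"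

definition controls ::
  "'a measure \<Rightarrow> (real \<Rightarrow> 'a measure) \<Rightarrow> (real \<Rightarrow> 'a \<Rightarrow> real) set" where
  "controls M F =
     {C. progressively_measurable F C \<and> (\<forall>t\<ge>0. \<forall>\<omega>\<in>space M. 0 \<le> C t \<omega>)}"

text \<open>
  The wealth equation is read pathwise in integrated form. Below, \<open>\<rho>\<close> and \<open>c\<close> are single
  paths of the interest rate and of the consumption rate.
\<close>

definition solves_wealth_eq ::
  "(real \<Rightarrow> real) \<Rightarrow> (real \<Rightarrow> real) \<Rightarrow> real \<Rightarrow> real \<Rightarrow> (real \<Rightarrow> real) \<Rightarrow> bool" where
  "solves_wealth_eq \<rho> c v T V \<longleftrightarrow>
     set_integrable lborel {0..T} (\<lambda>s. \<rho> s * V s - c s) \<and>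
     (\<forall>t\<in>{0..T}. V t = v + (LBINT s:{0..t}. \<rho> s * V s - c s))"

text \<open>
  For a continuous rate path the solution on \<open>{0..t}\<close> is unique, and it exists iff \<open>c\<close> is
  integrable on \<open>{0..t}\<close>. Controls need not have locally integrable paths; once the equation
  can no longer be solved, the wealth is set to 0, so that such a path counts as ruined and
  yields no further utility.
\<close>

definition wealth :: "(real \<Rightarrow> real) \<Rightarrow> (real \<Rightarrow> real) \<Rightarrow> real \<Rightarrow> real \<Rightarrow> real" where
  "wealth \<rho> c v t =
     (if \<exists>V. solves_wealth_eq \<rho> c v t V
      then (THE x. \<exists>V. solves_wealth_eq \<rho> c v t V \<and> V t = x)
      else 0)"

definition ruin_time :: "(real \<Rightarrow> real) \<Rightarrow> (real \<Rightarrow> real) \<Rightarrow> real \<Rightarrow> ennreal" where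
  "ruin_time \<rho> c v = Inf {ennreal t | t. 0 \<le> t \<and> wealth \<rho> c v t = 0}"

text \<open>
  The rate process \<open>R\<close> carries its starting point, so the expectation given the initial rate
  is the expectation under \<open>M\<close>.
\<close>

definition payoff_A ::
  "'a measure \<Rightarrow> real \<Rightarrow> real \<Rightarrow> (real \<Rightarrow> 'a \<Rightarrow> real) \<Rightarrow> (real \<Rightarrow> 'a \<Rightarrow> real) \<Rightarrow> real \<Rightarrow> ennreal" where
  "payoff_A M \<gamma> \<alpha> R C v =
     (\<integral>\<^sup>+\<omega>. (\<integral>\<^sup>+t\<in>{t. 0 \<le> t \<and> ennreal t < ruin_time (\<lambda>s. R s \<omega>) (\<lambda>s. C s \<omega>) v}.
                ennreal (exp (- \<gamma> * t) * C t \<omega> powr \<alpha>) \<partial>lborel) \<partial>M)"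

definition value_A ::
  "'a measure \<Rightarrow> (real \<Rightarrow> 'a measure) \<Rightarrow> real \<Rightarrow> real \<Rightarrow> (real \<Rightarrow> 'a \<Rightarrow> real) \<Rightarrow> real \<Rightarrow> ennreal" where
  "value_A M F \<gamma> \<alpha> R v = (SUP C\<in>controls M F. payoff_A M \<gamma> \<alpha> R C v)"

definition drifted_bm ::
  "real \<Rightarrow> real \<Rightarrow> (real \<Rightarrow> 'a \<Rightarrow> real) \<Rightarrow> real \<Rightarrow> real \<Rightarrow> 'a \<Rightarrow> real" where
  "drifted_bm \<mu> \<sigma> W r t \<omega> = r + \<mu> * t + \<sigma> * W t \<omega>"

definition geometric_bm ::
  "real \<Rightarrow> real \<Rightarrow> (real \<Rightarrow> 'a \<Rightarrow> real) \<Rightarrow> real \<Rightarrow> real \<Rightarrow> 'a \<Rightarrow> real" where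
  "geometric_bm \<mu> \<sigma> W r t \<omega> = r * exp ((\<mu> - \<sigma>\<^sup>2 / 2) * t + \<sigma> * W t \<omega>)"

end

theory Submission
  imports Defs "HOL-Real_Asymp.Real_Asymp"
begin

text \<open>
  Both assertions rest on a lower bound for the exponential moments of the integrated interest
  rate. For a probability measure \<open>Q\<close> with density \<open>exp L\<close>, Jensen's inequality gives
  \<open>E (exp Y) \<ge> exp (E\<^sub>Q (Y - L))\<close> (\<open>gibbs_variational_bound\<close>). It is applied with the measure
  \<open>Q\<close> under which the Brownian motion has the constant drift \<open>\<theta>\<close> up to time \<open>t\<close>. The price, the
  relative entropy of \<open>Q\<close>, is \<open>\<theta>\<^sup>2 * t / 2\<close>; the gain is the mean of the integrated rate under \<open>Q\<close>.
  This mean is explicit, because \<open>W s\<close> is normal with mean \<open>\<theta> * s\<close> and variance \<open>s\<close> under \<open>Q\<close>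
  (\<open>girsanov_distributed\<close>, \<open>exp_primitive_lower_bound\<close>).

  For the drifted Brownian motion, a drift \<open>\<theta>\<close> proportional to \<open>t\<close> yields an exponent that is cubic
  in \<open>t\<close> with positive leading coefficient. For the geometric Brownian motion, the mean rate is
  \<open>r * exp ((\<mu> + \<sigma> * \<theta>) * s)\<close>, so for each fixed \<open>t > 0\<close> the gain is
  exponential in \<open>\<sigma> * \<theta>\<close> and outgrows the entropy. In both models the
  exponent therefore absorbs any term linear in \<open>t\<close>, in particular
  \<open>- \<gamma> * t - \<alpha> * c * t\<close>: the expectation of the integrand is at least 1 for all large \<open>t\<close>, and by
  Tonelli's theorem the integral over time diverges (\<open>nn_integral_time_eq_top\<close>).

  The value function inherits the divergence: an investor who consumes at the rate \<open>c\<close> times the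
  current wealth keeps the positive wealth \<open>v * exp (\<integral> (r\<^sub>s - c) ds)\<close>, is never ruined, and for
  \<open>c = 1 / v\<close> obtains exactly the divergent integral as payoff (\<open>value_A_ge_proportional\<close>).
\<close>

section \<open>Primitives of continuous paths\<close>

lemma set_lebesgue_integral_eq_integral:
  fixes f :: "real \<Rightarrow> real"
  assumes "continuous_on {a..b} f"
  shows "(LBINT s:{a..b}. f s) = integral {a..b} f"
  by (intro set_borel_integral_eq_integral borel_integrable_atLeastAtMost' assms)

lemma primitive_0: "(LBINT s:{0..0::real}. f s) = (0 :: real)"
proof -
  have "continuous_on {0..0} f" by simp
  from set_lebesgue_integral_eq_integral[OF this] integral_refl[of "0::real" f] show ?thesis
    by simp
qed

lemma primitive_has_derivative:
  fixes f :: "real \<Rightarrow> real"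
  assumes f: "continuous_on {0..T} f" and t: "t \<in> {0..T}"
  shows "((\<lambda>t. LBINT s:{0..t}. f s) has_real_derivative f t) (at t within {0..T})"
proof (rule has_field_derivative_transform_within[where d = 1])
  show "((\<lambda>t. integral {0..t} f) has_real_derivative f t) (at t within {0..T})"
    using f t by (rule integral_has_real_derivative)
  show "integral {0..u} f = (LBINT s:{0..u}. f s)" if "u \<in> {0..T}" for u
    using that by (intro set_lebesgue_integral_eq_integral[symmetric] continuous_on_subset[OF f]) auto
qed (use t in auto)

lemma continuous_on_primitive:
  fixes f :: "real \<Rightarrow> real"
  assumes "continuous_on {0..} f"
  shows "continuous_on {0..} (\<lambda>t. LBINT s:{0..t}. f s)"
  unfolding continuous_on_eq_continuous_within
proof
  fix t :: real assume t: "t \<in> {0..}"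
  have "((\<lambda>t. LBINT s:{0..t}. f s) has_real_derivative f t) (at t within {0..t+1})"
    using t by (intro primitive_has_derivative continuous_on_subset[OF assms]) auto
  then have "continuous (at t within {0..t+1}) (\<lambda>t. LBINT s:{0..t}. f s)"
    by (metis DERIV_continuous)
  moreover have "at t within {0..t+1} = at t within {0..}"
    by (rule at_within_nhd[where S = "{..<t+1}"]) auto
  ultimately show "continuous (at t within {0..}) (\<lambda>t. LBINT s:{0..t}. f s)" by simp
qed

lemma primitive_diff_const:
  fixes f :: "real \<Rightarrow> real"
  assumes "0 \<le> t" "continuous_on {0..t} f"
  shows "(LBINT s:{0..t}. f s - c) = (LBINT s:{0..t}. f s) - c * t"
proof -
  have "(LBINT s:{0..t}. f s - c) = (LBINT s:{0..t}. f s) - (LBINT s:{0..t}. c)"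
    using assms by (intro set_integral_diff borel_integrable_atLeastAtMost' continuous_intros)
  with assms show ?thesis by (simp add: set_integral_const mult.commute)
qed

lemma primitive_linear:
  fixes p q :: real
  assumes "0 \<le> t"
  shows "(LBINT s:{0..t}. p + q * s) = p * t + q * t\<^sup>2 / 2"
proof -
  have "((\<lambda>s. p + q * s) has_integral (p * t + q * t\<^sup>2 / 2) - (p * 0 + q * 0\<^sup>2 / 2)) {0..t}"
    by (intro fundamental_theorem_of_calculus assms)
       (auto simp: has_real_derivative_iff_has_vector_derivative[symmetric] intro!: derivative_eq_intros)
  then show ?thesis
    by (subst set_lebesgue_integral_eq_integral) (auto intro!: continuous_intros integral_unique)
qed

lemma primitive_exp:
  fixes r x :: real
  assumes "0 \<le> t" "x \<noteq> 0"
  shows "(LBINT s:{0..t}. r * exp (x * s)) = r * ((exp (x * t) - 1) / x)"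
proof -
  have "((\<lambda>s. r * exp (x * s)) has_integral r * exp (x * t) / x - r * exp (x * 0) / x) {0..t}"
    using assms by (intro fundamental_theorem_of_calculus)
       (auto simp: has_real_derivative_iff_has_vector_derivative[symmetric] intro!: derivative_eq_intros)
  then show ?thesis
    by (subst set_lebesgue_integral_eq_integral)
       (auto intro!: continuous_intros dest!: integral_unique simp: right_diff_distrib diff_divide_distrib)
qed

section \<open>The wealth equation under proportional consumption\<close>

lemma solves_wealth_eq_continuous:
  assumes "solves_wealth_eq \<rho> c v T V"
  shows "continuous_on {0..T} V"
proof -
  let ?g = "\<lambda>s. \<rho> s * V s - c s"
  have int: "set_integrable lborel {0..T} ?g"
    and eq: "\<And>t. t \<in> {0..T} \<Longrightarrow> V t = v + (LBINT s:{0..t}. ?g s)"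
    using assms by (auto simp: solves_wealth_eq_def)
  have "V t = v + integral {0..t} ?g" if "t \<in> {0..T}" for t
    using that eq[OF that] set_borel_integral_eq_integral(2)[OF set_integrable_subset[OF int, of "{0..t}"]]
    by auto
  moreover have "continuous_on {0..T} (\<lambda>t. v + integral {0..t} ?g)"
    by (intro continuous_intros indefinite_integral_continuous_1 set_borel_integral_eq_integral(1) int)
  ultimately show ?thesis by (subst continuous_on_cong[OF refl]) auto
qed

text \<open>
  The difference of two solutions no longer contains the consumption: it solves the homogeneous
  linear equation with initial value 0. The consumption path may be irregular, so only the
  difference, whose derivative is continuous, can be treated by differential calculus.
\<close>

lemma solves_wealth_eq_unique:
  assumes T: "0 \<le> T" and \<rho>: "continuous_on {0..T} \<rho>"
    and V: "solves_wealth_eq \<rho> c v T V" and V': "solves_wealth_eq \<rho> c v T V'"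
  shows "V T = V' T"
proof -
  define D where "D t = V t - V' t" for t
  have contD: "continuous_on {0..T} (\<lambda>t. \<rho> t * D t)"
    unfolding D_def by (intro continuous_intros \<rho> solves_wealth_eq_continuous[OF V]
        solves_wealth_eq_continuous[OF V'])
  have D: "D t = (LBINT s:{0..t}. \<rho> s * D s)" if t: "t \<in> {0..T}" for t
  proof -
    have "set_integrable lborel {0..t} (\<lambda>s. \<rho> s * V s - c s)"
         "set_integrable lborel {0..t} (\<lambda>s. \<rho> s * V' s - c s)"
      using V V' t by (auto simp: solves_wealth_eq_def intro: set_integrable_subset)
    from set_integral_diff(2)[OF this] V V' t show ?thesis
      by (auto simp: solves_wealth_eq_def D_def right_diff_distrib)
  qed
  have dD: "(D has_real_derivative \<rho> t * D t) (at t within {0..T})" if t: "t \<in> {0..T}" for t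
    by (rule has_field_derivative_transform_within[OF primitive_has_derivative[OF contD t], of 1])
       (use D t in auto)
  \<comment> \<open>\<open>exp (- ?P)\<close> is the integrating factor of \<open>D' = \<rho> D\<close>.\<close>
  let ?P = "\<lambda>t. LBINT s:{0..t}. \<rho> s"
  let ?E = "\<lambda>t. D t * exp (- ?P t)"
  have "\<exists>k. \<forall>t\<in>{0..T}. ?E t = k"
  proof (rule has_field_derivative_zero_constant)
    fix t assume t: "t \<in> {0..T}"
    show "(?E has_real_derivative 0) (at t within {0..T})"
      by (rule derivative_eq_intros dD[OF t] primitive_has_derivative[OF \<rho> t] refl)+
         (simp add: algebra_simps)
  qed simp
  then obtain k where k: "\<And>t. t \<in> {0..T} \<Longrightarrow> ?E t = k" by blast
  have "D 0 = 0" using D[of 0] T by (simp only: primitive_0) simp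
  with k[of 0] T have "k = 0" by simp
  with k[of T] T show ?thesis by (simp add: D_def)
qed

lemma solves_wealth_eq_proportional:
  fixes c v :: real
  assumes \<rho>: "continuous_on {0..T} \<rho>"
  defines "V \<equiv> \<lambda>t. v * exp (LBINT s:{0..t}. \<rho> s - c)"
  shows "solves_wealth_eq \<rho> (\<lambda>t. c * V t) v T V"
proof -
  have cont: "continuous_on {0..T} (\<lambda>s. \<rho> s - c)" by (intro continuous_intros \<rho>)
  have dV: "(V has_real_derivative \<rho> t * V t - c * V t) (at t within {0..T})"
    if t: "t \<in> {0..T}" for t
    unfolding V_def
    by (rule derivative_eq_intros primitive_has_derivative[OF cont t] refl)+
       (simp add: algebra_simps)
  then have "continuous_on {0..T} V"
    using DERIV_continuous continuous_on_eq_continuous_within by blast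
  then have cont': "continuous_on {0..T} (\<lambda>t. \<rho> t * V t - c * V t)"
    by (intro continuous_intros \<rho>)
  have "V t = v + (LBINT s:{0..t}. \<rho> s * V s - c * V s)" if t: "t \<in> {0..T}" for t
  proof -
    have "((\<lambda>s. \<rho> s * V s - c * V s) has_integral V t - V 0) {0..t}"
    proof (rule fundamental_theorem_of_calculus)
      fix s assume "s \<in> {0..t}"
      with t have "(V has_real_derivative \<rho> s * V s - c * V s) (at s within {0..t})"
        by (intro DERIV_subset[OF dV]) auto
      then show "(V has_vector_derivative \<rho> s * V s - c * V s) (at s within {0..t})"
        by (simp add: has_real_derivative_iff_has_vector_derivative)
    qed (use t in simp)
    then have "integral {0..t} (\<lambda>s. \<rho> s * V s - c * V s) = V t - V 0" by (rule integral_unique)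
    moreover have "V 0 = v"
      by (simp only: V_def primitive_0 exp_zero mult_1_right)
    moreover have "(LBINT s:{0..t}. \<rho> s * V s - c * V s) = integral {0..t} (\<lambda>s. \<rho> s * V s - c * V s)"
      using t by (intro set_lebesgue_integral_eq_integral continuous_on_subset[OF cont']) auto
    ultimately show ?thesis by simp
  qed
  with borel_integrable_atLeastAtMost'[OF cont'] show ?thesis
    by (simp add: solves_wealth_eq_def)
qed

text \<open>
  Consuming the fraction \<open>c\<close> of the wealth per unit of time replaces the interest rate \<open>\<rho>\<close>
  by \<open>\<rho> - c\<close>. Here the consumption is given in closed form, as a function of the rate path
  alone, so that it is a control and not a feedback rule.
\<close>

lemma wealth_proportional:
  assumes t: "0 \<le> t" and \<rho>: "continuous_on {0..} \<rho>"
  shows "wealth \<rho> (\<lambda>t. c * (v * exp (LBINT s:{0..t}. \<rho> s - c))) v t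
           = v * exp (LBINT s:{0..t}. \<rho> s - c)"
proof -
  have \<rho>t: "continuous_on {0..t} \<rho>" by (rule continuous_on_subset[OF \<rho>]) auto
  note sol = solves_wealth_eq_proportional[OF \<rho>t, of c v]
  show ?thesis
    unfolding wealth_def
    by (subst if_P, metis sol, rule the_equality)
       (use sol solves_wealth_eq_unique[OF t \<rho>t _ sol] in blast)+
qed

lemma ruin_time_proportional:
  assumes v: "0 < v" and \<rho>: "continuous_on {0..} \<rho>"
  shows "ruin_time \<rho> (\<lambda>t. c * (v * exp (LBINT s:{0..t}. \<rho> s - c))) v = \<infinity>"
proof -
  have "{ennreal t | t. 0 \<le> t \<and> wealth \<rho> (\<lambda>t. c * (v * exp (LBINT s:{0..t}. \<rho> s - c))) v t = 0} = {}"
    using v by (auto simp: wealth_proportional[OF _ \<rho>])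
  then show ?thesis unfolding ruin_time_def by (simp only:) simp
qed

section \<open>Continuous adapted processes\<close>

text \<open>
  A function that is measurable in one variable and continuous in the other is jointly measurable,
  being the pointwise limit of functions that are piecewise constant in the continuous variable.
\<close>

lemma caratheodory_borel_measurable:
  fixes f :: "real \<Rightarrow> 'a \<Rightarrow> real"
  assumes meas: "\<And>t. f t \<in> borel_measurable N"
    and cont: "\<And>\<omega>. \<omega> \<in> space N \<Longrightarrow> continuous_on UNIV (\<lambda>t. f t \<omega>)"
  shows "(\<lambda>(t, \<omega>). f t \<omega>) \<in> borel_measurable (borel \<Otimes>\<^sub>M N)"
proof (rule borel_measurable_LIMSEQ_metric)
  let ?q = "\<lambda>n t. real_of_int \<lfloor>real (Suc n) * t\<rfloor> / real (Suc n)"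
  \<comment> \<open>The time is rounded down to a multiple of \<open>1 / (n + 1)\<close>, so that only countably many random variables are involved.\<close>
  fix n
  have "(\<lambda>p. f (real_of_int (\<lfloor>real (Suc n) * fst p\<rfloor>) / real (Suc n)) (snd p))
          \<in> borel_measurable (borel \<Otimes>\<^sub>M N)"
    by (rule measurable_compose_countable[where g = "\<lambda>p. \<lfloor>real (Suc n) * fst p\<rfloor>"
          and f = "\<lambda>i p. f (real_of_int i / real (Suc n)) (snd p)"])
       (auto intro: measurable_compose[OF measurable_snd meas])
  then show "(\<lambda>(t, \<omega>). f (?q n t) \<omega>) \<in> borel_measurable (borel \<Otimes>\<^sub>M N)"
    by (simp add: case_prod_beta)
next
  let ?q = "\<lambda>n t. real_of_int \<lfloor>real (Suc n) * t\<rfloor> / real (Suc n)"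
  fix p :: "real \<times> 'a" assume "p \<in> space (borel \<Otimes>\<^sub>M N)"
  then have p: "snd p \<in> space N" by (auto simp: space_pair_measure)
  have "(\<lambda>n. ?q n (fst p)) \<longlonglongrightarrow> fst p"
  proof (rule real_tendsto_sandwich)
    show "\<forall>\<^sub>F n in sequentially. fst p - 1 / real (Suc n) \<le> ?q n (fst p)"
    proof (intro always_eventually allI)
      fix n
      have "real (Suc n) * fst p - 1 \<le> real_of_int \<lfloor>real (Suc n) * fst p\<rfloor>" by linarith
      then have "(real (Suc n) * fst p - 1) / real (Suc n) \<le> ?q n (fst p)"
        by (rule divide_right_mono) simp
      then show "fst p - 1 / real (Suc n) \<le> ?q n (fst p)" by (simp add: diff_divide_distrib)
    qed
    show "\<forall>\<^sub>F n in sequentially. ?q n (fst p) \<le> fst p"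
    proof (intro always_eventually allI)
      fix n
      have "?q n (fst p) \<le> real (Suc n) * fst p / real (Suc n)"
        by (rule divide_right_mono) auto
      then show "?q n (fst p) \<le> fst p" by simp
    qed
    show "(\<lambda>n. fst p - 1 / real (Suc n)) \<longlonglongrightarrow> fst p"
      using tendsto_diff[OF tendsto_const LIMSEQ_inverse_real_of_nat, of "fst p"]
      by (simp add: inverse_eq_divide)
  qed simp
  then have "(\<lambda>n. f (?q n (fst p)) (snd p)) \<longlonglongrightarrow> f (fst p) (snd p)"
    using continuous_on_tendsto_compose[OF cont[OF p]] by auto
  then show "(\<lambda>n. case p of (t, \<omega>) \<Rightarrow> f (?q n t) \<omega>) \<longlonglongrightarrow> (case p of (t, \<omega>) \<Rightarrow> f t \<omega>)"
    by (simp add: case_prod_beta)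
qed

lemma borel_measurable_primitive:
  fixes \<rho> :: "real \<Rightarrow> 'a \<Rightarrow> real"
  assumes t: "0 \<le> t" and meas: "\<And>s. 0 \<le> s \<Longrightarrow> s \<le> t \<Longrightarrow> \<rho> s \<in> borel_measurable N"
    and cont: "\<And>\<omega>. \<omega> \<in> space N \<Longrightarrow> continuous_on {0..t} (\<lambda>s. \<rho> s \<omega>)"
  shows "(\<lambda>\<omega>. LBINT s:{0..t}. \<rho> s \<omega>) \<in> borel_measurable N"
proof -
  let ?g = "\<lambda>s. max 0 (min t s)"
  have "(\<lambda>(s, \<omega>). \<rho> (?g s) \<omega>) \<in> borel_measurable (borel \<Otimes>\<^sub>M N)"
    using t by (intro caratheodory_borel_measurable meas
        continuous_on_compose2[OF cont] continuous_intros) auto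
  from measurable_compose[OF measurable_pair_swap' this]
  have [measurable]: "(\<lambda>(\<omega>, s). \<rho> (?g s) \<omega>) \<in> borel_measurable (N \<Otimes>\<^sub>M borel)"
    by (simp add: case_prod_beta)
  have "(\<lambda>\<omega>. LINT s|lborel. indicator {0..t} s *\<^sub>R \<rho> (?g s) \<omega>) \<in> borel_measurable N"
    by measurable
  moreover have "(\<lambda>\<omega>. LBINT s:{0..t}. \<rho> s \<omega>)
      = (\<lambda>\<omega>. LINT s|lborel. indicator {0..t} s *\<^sub>R \<rho> (?g s) \<omega>)"
    unfolding set_lebesgue_integral_def
    by (intro ext Bochner_Integration.integral_cong refl) (auto simp: indicator_def)
  ultimately show ?thesis by (simp only:)
qed

definition continuous_adapted ::
  "'a measure \<Rightarrow> (real \<Rightarrow> 'a measure) \<Rightarrow> (real \<Rightarrow> 'a \<Rightarrow> real) \<Rightarrow> bool" where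
  "continuous_adapted M F X \<longleftrightarrow>
     (\<forall>t\<ge>0. X t \<in> borel_measurable (F t)) \<and>
     (\<forall>\<omega>\<in>space M. continuous_on {0..} (\<lambda>t. X t \<omega>))"

lemma adapted_mono:
  assumes F: "filtered_prob_space M F" and X: "continuous_adapted M F X"
    and "0 \<le> s" "s \<le> t"
  shows "X s \<in> borel_measurable (F t)"
  using assms measurable_from_subalg[of "F t" "F s" "X s" borel]
  by (auto simp: filtered_prob_space_def continuous_adapted_def)

lemma adapted_measurable:
  assumes F: "filtered_prob_space M F" and X: "continuous_adapted M F X" and "0 \<le> s"
  shows "X s \<in> borel_measurable M"
  using assms measurable_from_subalg[of M "F s" "X s" borel]
  by (auto simp: filtered_prob_space_def continuous_adapted_def)

lemma space_filtration: "filtered_prob_space M F \<Longrightarrow> 0 \<le> t \<Longrightarrow> space (F t) = space M"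
  by (auto simp: filtered_prob_space_def subalgebra_def)

lemma continuous_adapted_primitive:
  assumes F: "filtered_prob_space M F" and X: "continuous_adapted M F X"
  shows "continuous_adapted M F (\<lambda>t \<omega>. LBINT s:{0..t}. X s \<omega>)"
  unfolding continuous_adapted_def
proof (intro conjI allI ballI impI)
  fix t :: real assume t: "0 \<le> t"
  show "(\<lambda>\<omega>. LBINT s:{0..t}. X s \<omega>) \<in> borel_measurable (F t)"
    using X t by (intro borel_measurable_primitive adapted_mono[OF F X])
      (auto simp: space_filtration[OF F t] continuous_adapted_def intro: continuous_on_subset)
next
  fix \<omega> assume "\<omega> \<in> space M"
  with X show "continuous_on {0..} (\<lambda>t. LBINT s:{0..t}. X s \<omega>)"
    by (intro continuous_on_primitive) (auto simp: continuous_adapted_def)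
qed

lemma continuous_adapted_compose:
  assumes X: "continuous_adapted M F X" and g: "continuous_on UNIV (\<lambda>(t, x). g t x :: real)"
  shows "continuous_adapted M F (\<lambda>t \<omega>. g t (X t \<omega>))"
  unfolding continuous_adapted_def
proof (intro conjI allI ballI impI)
  fix t :: real assume t: "0 \<le> t"
  have "continuous_on UNIV (\<lambda>x::real. (t, x))"
    by (intro continuous_on_Pair continuous_on_const continuous_on_id)
  then have "continuous_on UNIV (\<lambda>x. g t x)"
    using continuous_on_compose2[OF g, of UNIV "\<lambda>x. (t, x)"] by auto
  with X t show "(\<lambda>\<omega>. g t (X t \<omega>)) \<in> borel_measurable (F t)"
    by (auto simp: continuous_adapted_def intro: borel_measurable_continuous_on)
next
  fix \<omega> assume "\<omega> \<in> space M"
  with X have "continuous_on {0..} (\<lambda>t. (t, X t \<omega>))"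
    by (intro continuous_on_Pair continuous_on_id) (simp add: continuous_adapted_def)
  from continuous_on_compose2[OF g this] show "continuous_on {0..} (\<lambda>t. g t (X t \<omega>))"
    by simp
qed

text \<open>
  Nothing is known about \<open>X\<close> at negative times; stopping the clock at 0 makes the statement
  meaningful on the whole line.
\<close>

lemma joint_measurable:
  assumes F: "filtered_prob_space M F" and X: "continuous_adapted M F X"
  shows "(\<lambda>(t, \<omega>). X (max 0 t) \<omega>) \<in> borel_measurable (borel \<Otimes>\<^sub>M M)"
  using X by (intro caratheodory_borel_measurable adapted_measurable[OF F X])
    (auto simp: continuous_adapted_def
      intro!: continuous_on_compose2[where s = UNIV and t = "{0..}" and f = "max 0"] continuous_intros)

lemma continuous_adapted_progressively_measurable:
  assumes F: "filtered_prob_space M F" and X: "continuous_adapted M F X"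
  shows "progressively_measurable F X"
  unfolding progressively_measurable_def
proof (intro allI impI)
  fix T :: real assume T: "0 \<le> T"
  let ?g = "\<lambda>s. max 0 (min T s)"
  have "(\<lambda>(t, \<omega>). X (?g t) \<omega>) \<in> borel_measurable (borel \<Otimes>\<^sub>M F T)"
    using T X space_filtration[OF F T]
    by (intro caratheodory_borel_measurable adapted_mono[OF F X])
       (auto simp: continuous_adapted_def 
      intro!: continuous_on_compose2[where s = UNIV and t = "{0..}" and f = ?g] continuous_intros)
  moreover have "fst \<in> measurable (restrict_space borel {0..T} \<Otimes>\<^sub>M F T) borel"
    by (rule measurable_compose[OF measurable_fst measurable_restrict_space1[OF measurable_ident_sets[OF refl]]])
  then have "(\<lambda>p. (fst p, snd p)) \<in>
      measurable (restrict_space borel {0..T} \<Otimes>\<^sub>M F T) (borel \<Otimes>\<^sub>M F T)"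
    by (intro measurable_Pair measurable_snd)
  ultimately have "(\<lambda>p. X (?g (fst p)) (snd p)) \<in>
      borel_measurable (restrict_space borel {0..T} \<Otimes>\<^sub>M F T)"
    using measurable_compose by (fastforce simp: case_prod_beta)
  then show "(\<lambda>(t, \<omega>). X t \<omega>) \<in> borel_measurable (restrict_space borel {0..T} \<Otimes>\<^sub>M F T)"
    by (rule measurable_cong[THEN iffD1, rotated])
       (auto simp: space_pair_measure space_restrict_space)
qed

section \<open>Exponential tilts and the Gibbs variational bound\<close>

lemma normal_density_exp_tilt:
  assumes "0 < s"
  shows "normal_density m (sqrt s) x * exp (a * x)
           = exp (a * m + a\<^sup>2 * s / 2) * normal_density (m + a * s) (sqrt s) x"
proof -
  have "- (x - m)\<^sup>2 / (2 * s) + a * x = a * m + a\<^sup>2 * s / 2 + - (x - (m + a * s))\<^sup>2 / (2 * s)"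
    using assms by (simp add: field_simps power2_eq_square)
  then have "exp (- (x - m)\<^sup>2 / (2 * s)) * exp (a * x)
      = exp (a * m + a\<^sup>2 * s / 2) * exp (- (x - (m + a * s))\<^sup>2 / (2 * s))"
    by (simp only: exp_add[symmetric])
  with assms show ?thesis by (simp add: normal_density_def)
qed

lemma normal_density_nn_integral_1: "0 < s \<Longrightarrow> (\<integral>\<^sup>+x. ennreal (normal_density m (sqrt s) x) \<partial>lborel) = 1"
  by (subst nn_integral_eq_integral) auto

lemma normal_exp_moment:
  assumes "0 < s"
  shows "has_bochner_integral lborel (\<lambda>x. normal_density m (sqrt s) x * exp (a * x))
           (exp (a * m + a\<^sup>2 * s / 2))"
  unfolding normal_density_exp_tilt[OF assms]
  using assms by (auto simp: has_bochner_integral_iff)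

text \<open>
  One half of the Gibbs variational principle: the logarithm of the expectation of \<open>exp Y\<close> is at
  least the mean of \<open>Y\<close> under any \<open>Q\<close> minus the relative entropy of \<open>Q\<close>, which is the mean of
  its log-density \<open>L\<close>. It is Jensen's inequality for \<open>exp (Y - L)\<close> under \<open>Q\<close>.
\<close>

lemma gibbs_variational_bound:
  fixes M :: "'a measure" and L Y :: "'a \<Rightarrow> real"
  defines "Q \<equiv> density M (\<lambda>\<omega>. ennreal (exp (L \<omega>)))"
  assumes L: "L \<in> borel_measurable M" and Y: "Y \<in> borel_measurable M"
    and Q: "prob_space (Q)" and int: "integrable (Q) (\<lambda>\<omega>. Y \<omega> - L \<omega>)"
  shows "ennreal (exp (LINT \<omega>|Q. Y \<omega> - L \<omega>)) \<le> (\<integral>\<^sup>+\<omega>. ennreal (exp (Y \<omega>)) \<partial>M)"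
proof -
  interpret Q: prob_space "Q" by fact
  note [measurable] = L Y
  have eq: "(\<integral>\<^sup>+\<omega>. ennreal (exp (Y \<omega>)) \<partial>M) = (\<integral>\<^sup>+\<omega>. ennreal (exp (Y \<omega> - L \<omega>)) \<partial>Q)"
    unfolding Q_def by (subst nn_integral_density) (auto simp: ennreal_mult[symmetric] exp_diff)
  show ?thesis
  proof (cases "integrable (Q) (\<lambda>\<omega>. exp (Y \<omega> - L \<omega>))")
    case True
    have "exp (LINT \<omega>|Q. Y \<omega> - L \<omega>) \<le> (LINT \<omega>|Q. exp (Y \<omega> - L \<omega>))"
      by (rule Q.jensens_inequality[OF int, of UNIV]) (use True exp_convex in auto)
    with True show ?thesis unfolding eq
      by (subst nn_integral_eq_integral) (auto intro: ennreal_leI)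
  next
    case False
    \<comment> \<open>Jensen's inequality is not applicable, but then the right-hand side is infinite anyway.\<close>
    then have "(\<integral>\<^sup>+\<omega>. ennreal (exp (Y \<omega> - L \<omega>)) \<partial>Q) = \<infinity>"
      by (subst (asm) integrable_iff_bounded) (auto simp: Q_def less_top[symmetric])
    then show ?thesis unfolding eq by simp
  qed
qed

lemma (in prob_space) indep_var_nn_integral_mult:
  fixes f g :: "real \<Rightarrow> ennreal"
  assumes ind: "indep_var borel X borel Y"
    and [measurable]: "f \<in> borel_measurable borel" "g \<in> borel_measurable borel"
  shows "(\<integral>\<^sup>+\<omega>. f (X \<omega>) * g (Y \<omega>) \<partial>M) = (\<integral>\<^sup>+\<omega>. f (X \<omega>) \<partial>M) * (\<integral>\<^sup>+\<omega>. g (Y \<omega>) \<partial>M)"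
proof -
  have [measurable]: "X \<in> borel_measurable M" "Y \<in> borel_measurable M"
    and prod: "distr M borel X \<Otimes>\<^sub>M distr M borel Y
      = distr M (borel \<Otimes>\<^sub>M borel) (\<lambda>\<omega>. (X \<omega>, Y \<omega>))"
    using ind by (auto simp: indep_var_distribution_eq)
  interpret Y: prob_space "distr M borel Y" by (rule prob_space_distr) simp
  have "(\<integral>\<^sup>+\<omega>. f (X \<omega>) * g (Y \<omega>) \<partial>M)
      = (\<integral>\<^sup>+p. f (fst p) * g (snd p) \<partial>(distr M borel X \<Otimes>\<^sub>M distr M borel Y))"
    unfolding prod by (subst nn_integral_distr) auto
  also have "\<dots> = (\<integral>\<^sup>+x. \<integral>\<^sup>+y. f x * g y \<partial>distr M borel Y \<partial>distr M borel X)"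
    by (subst Y.nn_integral_fst[symmetric]) auto
  also have "\<dots> = (\<integral>\<^sup>+\<omega>. f (X \<omega>) \<partial>M) * (\<integral>\<^sup>+\<omega>. g (Y \<omega>) \<partial>M)"
    by (simp add: nn_integral_cmult nn_integral_multc nn_integral_distr)
  finally show ?thesis .
qed

section \<open>Brownian motion under a constant drift\<close>

lemma brownian_continuous_adapted: "brownian_motion M F W \<Longrightarrow> continuous_adapted M F W"
  by (simp add: brownian_motion_def continuous_adapted_def)

lemma brownian_distributed:
  assumes F: "filtered_prob_space M F" and W: "brownian_motion M F W" and t: "0 < t"
  shows "distributed M lborel (W t) (\<lambda>x. ennreal (normal_density 0 (sqrt t) x))"
proof -
  note [measurable] = adapted_measurable[OF F brownian_continuous_adapted[OF W]]
  have [measurable]: "W t \<in> borel_measurable M" "W 0 \<in> borel_measurable M" using t by auto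
  have "distributed M lborel (\<lambda>\<omega>. W t \<omega> - W s \<omega>)
      (\<lambda>x. ennreal (normal_density 0 (sqrt (t - s)) x))" if "0 \<le> s" "s < t" for s
    using W that by (simp add: brownian_motion_def)
  from this[of 0] t
  have inc: "distributed M lborel (\<lambda>\<omega>. W t \<omega> - W 0 \<omega>) (\<lambda>x. ennreal (normal_density 0 (sqrt t) x))"
    by simp
  have W0: "AE \<omega> in M. W 0 \<omega> = 0"
    using W by (simp add: brownian_motion_def)
  have "distr M lborel (W t) = distr M lborel (\<lambda>\<omega>. W t \<omega> - W 0 \<omega>)"
    by (rule distr_cong_AE) (use W0 in auto)
  with inc show ?thesis by (simp add: distributed_def)
qed

lemma brownian_increment_indep:
  assumes F: "filtered_prob_space M F" and W: "brownian_motion M F W" and st: "0 \<le> s" "s < t"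
  shows "prob_space.indep_var M borel (W s) borel (\<lambda>\<omega>. W t \<omega> - W s \<omega>)"
proof -
  interpret prob_space M using F by (simp add: filtered_prob_space_def)
  have [measurable]: "W t \<in> borel_measurable M" "W s \<in> borel_measurable M"
    using st by (auto intro!: adapted_measurable[OF F brownian_continuous_adapted[OF W]])
  have Ws: "W s \<in> borel_measurable (F s)" using W st by (simp add: brownian_motion_def)
  have ind: "indep_set (sets (F s))
      (sets (vimage_algebra (space M) (\<lambda>\<omega>. W t \<omega> - W s \<omega>) borel))"
    using W st by (simp add: brownian_motion_def)
  have "{W s -` A \<inter> space M | A. A \<in> sets borel} \<subseteq> sets (F s)"
    using measurable_sets[OF Ws] by (auto simp: space_filtration[OF F st(1)])
  then have sub: "sigma_sets (space M) {W s -` A \<inter> space M | A. A \<in> sets borel} \<subseteq> sets (F s)"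
    using sets.sigma_sets_subset[of _ "F s"] by (simp add: space_filtration[OF F st(1)])
  show ?thesis
    unfolding indep_var_eq
    using ind sub unfolding indep_set_def sets_vimage_algebra
    by (intro conjI, simp, simp, elim indep_sets_mono_sets) (auto split: bool.split)
qed

text \<open>
  The logarithm of the Cameron--Martin density on \<open>{0..t}\<close>, under which the Brownian motion acquires
  the constant drift \<open>\<theta>\<close>.
\<close>

definition girsanov_log_density :: "(real \<Rightarrow> 'a \<Rightarrow> real) \<Rightarrow> real \<Rightarrow> real \<Rightarrow> 'a \<Rightarrow> real" where
  "girsanov_log_density W \<theta> t \<omega> = \<theta> * W t \<omega> - \<theta>\<^sup>2 * t / 2"

definition girsanov ::
  "'a measure \<Rightarrow> (real \<Rightarrow> 'a \<Rightarrow> real) \<Rightarrow> real \<Rightarrow> real \<Rightarrow> 'a measure" where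
  "girsanov M W \<theta> t = density M (\<lambda>\<omega>. ennreal (exp (girsanov_log_density W \<theta> t \<omega>)))"

lemma girsanov_nn_integral_endpoint:
  fixes g :: "real \<Rightarrow> ennreal"
  assumes X: "distributed M lborel X (\<lambda>x. ennreal (normal_density 0 (sqrt t) x))"
    and t: "0 < t" and [measurable]: "g \<in> borel_measurable borel"
  shows "(\<integral>\<^sup>+\<omega>. ennreal (exp (\<theta> * X \<omega> - \<theta>\<^sup>2 * t / 2)) * g (X \<omega>) \<partial>M)
           = (\<integral>\<^sup>+x. ennreal (normal_density (\<theta> * t) (sqrt t) x) * g x \<partial>lborel)"
proof -
  have "(\<integral>\<^sup>+\<omega>. ennreal (exp (\<theta> * X \<omega> - \<theta>\<^sup>2 * t / 2)) * g (X \<omega>) \<partial>M)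
      = (\<integral>\<^sup>+x. ennreal (normal_density 0 (sqrt t) x)
                * (ennreal (exp (\<theta> * x - \<theta>\<^sup>2 * t / 2)) * g x) \<partial>lborel)"
    by (subst distributed_nn_integral[OF X]) auto
  also have "\<dots> = (\<integral>\<^sup>+x. ennreal (normal_density (\<theta> * t) (sqrt t) x) * g x \<partial>lborel)"
  proof (intro nn_integral_cong)
    fix x
    have "normal_density 0 (sqrt t) x * exp (\<theta> * x - \<theta>\<^sup>2 * t / 2) = normal_density (\<theta> * t) (sqrt t) x"
      using normal_density_exp_tilt[OF t, of 0 x \<theta>] by (simp add: exp_diff)
    then show "ennreal (normal_density 0 (sqrt t) x) * (ennreal (exp (\<theta> * x - \<theta>\<^sup>2 * t / 2)) * g x)
        = ennreal (normal_density (\<theta> * t) (sqrt t) x) * g x"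
      by (simp add: mult.assoc[symmetric] ennreal_mult[symmetric])
  qed
  finally show ?thesis .
qed

text \<open>
  The density factors into the one at time \<open>s\<close> and one built from the increment after \<open>s\<close>. The
  latter is independent of \<open>W s\<close> and has mean 1, so that only the tilt of the law of \<open>W s\<close> is left.
\<close>

lemma girsanov_nn_integral:
  fixes g :: "real \<Rightarrow> ennreal"
  assumes F: "filtered_prob_space M F" and W: "brownian_motion M F W"
    and s: "0 < s" "s \<le> t" and g[measurable]: "g \<in> borel_measurable borel"
  shows "(\<integral>\<^sup>+\<omega>. ennreal (exp (girsanov_log_density W \<theta> t \<omega>)) * g (W s \<omega>) \<partial>M)
           = (\<integral>\<^sup>+x. ennreal (normal_density (\<theta> * s) (sqrt s) x) * g x \<partial>lborel)"
proof (cases "s = t")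
  case True
  with s show ?thesis unfolding girsanov_log_density_def
    by (simp add: girsanov_nn_integral_endpoint[OF brownian_distributed[OF F W]])
next
  case False
  with s have st: "s < t" by simp
  interpret prob_space M using F by (simp add: filtered_prob_space_def)
  have inc: "distributed M lborel (\<lambda>\<omega>. W t \<omega> - W s \<omega>)
      (\<lambda>x. ennreal (normal_density 0 (sqrt (t - s)) x))"
    using W s st by (simp add: brownian_motion_def)
  have "(\<integral>\<^sup>+\<omega>. ennreal (exp (girsanov_log_density W \<theta> t \<omega>)) * g (W s \<omega>) \<partial>M)
      = (\<integral>\<^sup>+\<omega>. (ennreal (exp (\<theta> * W s \<omega> - \<theta>\<^sup>2 * s / 2)) * g (W s \<omega>))
              * (ennreal (exp (\<theta> * (W t \<omega> - W s \<omega>) - \<theta>\<^sup>2 * (t - s) / 2)) * 1) \<partial>M)"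
  proof (intro nn_integral_cong)
    fix \<omega>
    have "exp (girsanov_log_density W \<theta> t \<omega>) = exp (\<theta> * W s \<omega> - \<theta>\<^sup>2 * s / 2)
        * exp (\<theta> * (W t \<omega> - W s \<omega>) - \<theta>\<^sup>2 * (t - s) / 2)"
      unfolding girsanov_log_density_def exp_add[symmetric]
      by (rule arg_cong[where f = exp]) (simp add: field_simps)
    then show "ennreal (exp (girsanov_log_density W \<theta> t \<omega>)) * g (W s \<omega>)
        = (ennreal (exp (\<theta> * W s \<omega> - \<theta>\<^sup>2 * s / 2)) * g (W s \<omega>))
              * (ennreal (exp (\<theta> * (W t \<omega> - W s \<omega>) - \<theta>\<^sup>2 * (t - s) / 2)) * 1)"
      by (simp add: ennreal_mult ac_simps)
  qed
  also have "\<dots> = (\<integral>\<^sup>+\<omega>. ennreal (exp (\<theta> * W s \<omega> - \<theta>\<^sup>2 * s / 2)) * g (W s \<omega>) \<partial>M)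
      * (\<integral>\<^sup>+\<omega>. ennreal (exp (\<theta> * (W t \<omega> - W s \<omega>) - \<theta>\<^sup>2 * (t - s) / 2)) * 1 \<partial>M)"
    using s st by (intro indep_var_nn_integral_mult brownian_increment_indep[OF F W]) auto
  also have "\<dots> = (\<integral>\<^sup>+x. ennreal (normal_density (\<theta> * s) (sqrt s) x) * g x \<partial>lborel)"
    using st by (simp add: girsanov_nn_integral_endpoint[OF brownian_distributed[OF F W s(1)] s(1) g]
        girsanov_nn_integral_endpoint[OF inc, of "\<lambda>_. 1", simplified] normal_density_nn_integral_1)
  finally show ?thesis .
qed

lemma sets_girsanov[measurable_cong, simp]: "sets (girsanov M W \<theta> t) = sets M"
  by (simp add: girsanov_def)

text \<open>
  Of Girsanov's theorem only the one-dimensional marginals are needed, because the mean of a time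
  integral depends on nothing else.
\<close>

lemma girsanov_distributed:
  assumes F: "filtered_prob_space M F" and W: "brownian_motion M F W" and s: "0 < s" "s \<le> t"
  shows "distributed (girsanov M W \<theta> t) lborel (W s)
           (\<lambda>x. ennreal (normal_density (\<theta> * s) (sqrt s) x))"
proof -
  have meas[measurable]: "W u \<in> borel_measurable M" if "0 < u" for u
    using that by (intro adapted_measurable[OF F brownian_continuous_adapted[OF W]]) simp
  have ts: "0 < t" using s by simp
  note [measurable] = meas[OF s(1)] meas[OF ts]
  have [measurable]: "girsanov_log_density W \<theta> t \<in> borel_measurable M"
    unfolding girsanov_log_density_def[abs_def] by measurable
  have "distr (girsanov M W \<theta> t) lborel (W s) = density lborel (normal_density (\<theta> * s) (sqrt s))"
  proof (rule measure_eqI)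
    fix A assume "A \<in> sets (distr (girsanov M W \<theta> t) lborel (W s))"
    then have [measurable]: "A \<in> sets borel" by simp
    have "emeasure (distr (girsanov M W \<theta> t) lborel (W s)) A
        = (\<integral>\<^sup>+\<omega>. indicator A (W s \<omega>) \<partial>girsanov M W \<theta> t)"
      by (subst nn_integral_distr[symmetric, where f = "indicator A" and M' = lborel]) auto
    also have "\<dots> = (\<integral>\<^sup>+\<omega>. ennreal (exp (girsanov_log_density W \<theta> t \<omega>)) * indicator A (W s \<omega>) \<partial>M)"
      unfolding girsanov_def by (subst nn_integral_density) auto
    also have "\<dots> = (\<integral>\<^sup>+x. ennreal (normal_density (\<theta> * s) (sqrt s) x) * indicator A x \<partial>lborel)"
      using s by (intro girsanov_nn_integral[OF F W]) auto
    finally show "emeasure (distr (girsanov M W \<theta> t) lborel (W s)) A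
        = emeasure (density lborel (normal_density (\<theta> * s) (sqrt s))) A"
      by (subst emeasure_density) auto
  qed simp
  then show ?thesis by (simp add: distributed_def)
qed

lemma prob_space_girsanov:
  assumes F: "filtered_prob_space M F" and W: "brownian_motion M F W" and t: "0 < t"
  shows "prob_space (girsanov M W \<theta> t)"
proof -
  have D: "distributed (girsanov M W \<theta> t) lborel (W t)
      (\<lambda>x. ennreal (normal_density (\<theta> * t) (sqrt t) x))"
    using t by (intro girsanov_distributed[OF F W]) auto
  have "prob_space (density lborel (normal_density (\<theta> * t) (sqrt t)))"
    using t by (intro prob_space_normal_density) simp
  then have "prob_space (distr (girsanov M W \<theta> t) lborel (W t))"
    unfolding distributed_distr_eq_density[OF D] .
  moreover have "W t \<in> measurable (girsanov M W \<theta> t) lborel"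
    using D unfolding distributed_def by blast
  ultimately show ?thesis by (rule prob_space_distrD[rotated])
qed

lemma girsanov_exp_moment:
  assumes F: "filtered_prob_space M F" and W: "brownian_motion M F W" and s: "0 < s" "s \<le> t"
  shows "has_bochner_integral (girsanov M W \<theta> t) (\<lambda>\<omega>. exp (a * W s \<omega>))
           (exp (a * (\<theta> * s) + a\<^sup>2 * s / 2))"
proof -
  note D = girsanov_distributed[OF F W s, of \<theta>]
  note N = normal_exp_moment[OF s(1), of "\<theta> * s" a]
  show ?thesis
    using N distributed_integrable[OF D, of "\<lambda>x. exp (a * x)"]
      distributed_integral[OF D, of "\<lambda>x. exp (a * x)"]
    by (auto simp: has_bochner_integral_iff)
qed

lemma girsanov_brownian_mean:
  assumes F: "filtered_prob_space M F" and W: "brownian_motion M F W" and s: "0 < s" "s \<le> t"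
  shows "has_bochner_integral (girsanov M W \<theta> t) (W s) (\<theta> * s)"
proof -
  note D = girsanov_distributed[OF F W s, of \<theta>]
  have N: "has_bochner_integral lborel (\<lambda>x. normal_density (\<theta> * s) (sqrt s) x * x) (\<theta> * s)"
    using s by (intro normal_moment_nz_1) simp
  show ?thesis
    using N distributed_integrable[OF D, of "\<lambda>x. x"] distributed_integral[OF D, of "\<lambda>x. x"]
    by (auto simp: has_bochner_integral_iff)
qed

text \<open>
  Fubini's theorem for the mean of the integrated rate. The growth condition covers both models: it
  bounds the rate by exponentials of \<open>W s\<close>, whose means are bounded uniformly in \<open>s \<le> t\<close>.
\<close>

lemma girsanov_mean_primitive:
  fixes g :: "real \<Rightarrow> real \<Rightarrow> real"
  assumes F: "filtered_prob_space M F" and W: "brownian_motion M F W" and t: "0 < t"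
    and g: "continuous_on UNIV (\<lambda>(s, x). g s x)"
    and growth: "\<And>s x. 0 \<le> s \<Longrightarrow> s \<le> t \<Longrightarrow> \<bar>g s x\<bar> \<le> A * (exp (B * x) + exp (- B * x))"
    and m: "continuous_on {0..t} m"
    and mean: "\<And>s. 0 < s \<Longrightarrow> s \<le> t \<Longrightarrow> (LINT \<omega>|girsanov M W \<theta> t. g s (W s \<omega>)) = m s"
  shows "has_bochner_integral (girsanov M W \<theta> t) (\<lambda>\<omega>. LBINT s:{0..t}. g s (W s \<omega>))
           (LBINT s:{0..t}. m s)"
proof -
  let ?Q = "girsanov M W \<theta> t"
  interpret Q: prob_space ?Q by (rule prob_space_girsanov[OF F W t])
  interpret P: pair_sigma_finite lborel ?Q by standard
  define X where "X s \<omega> = g s (W s \<omega>)" for s \<omega>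
  define f where "f s \<omega> = indicator {0..t} s * X (max 0 s) \<omega>" for s \<omega>
  have X: "continuous_adapted M F X"
    unfolding X_def by (rule continuous_adapted_compose[OF brownian_continuous_adapted[OF W] g])
  have sets_eq: "sets (lborel \<Otimes>\<^sub>M ?Q) = sets (borel \<Otimes>\<^sub>M M)"
    by (rule sets_pair_measure_cong) simp_all
  have "(\<lambda>(s, \<omega>). X (max 0 s) \<omega>) \<in> borel_measurable (lborel \<Otimes>\<^sub>M ?Q)"
    using joint_measurable[OF F X] unfolding measurable_cong_sets[OF sets_eq refl] .
  then have [measurable]: "(\<lambda>p. X (max 0 (fst p)) (snd p)) \<in> borel_measurable (lborel \<Otimes>\<^sub>M ?Q)"
    by (simp add: case_prod_beta)
  have f[measurable]: "case_prod f \<in> borel_measurable (lborel \<Otimes>\<^sub>M ?Q)"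
    unfolding f_def case_prod_beta by measurable
  have Xm: "X s \<in> borel_measurable ?Q" if "0 \<le> s" for s
    using adapted_measurable[OF F X that] by simp
  have A: "0 \<le> A" using growth[of 0 0] t by auto
  \<comment> \<open>A bound on the expectation of \<open>\<bar>X s\<bar>\<close> that is uniform in \<open>s \<le> t\<close>, as Fubini's theorem requires.\<close>
  define K where "K = A * (exp (\<bar>B * \<theta>\<bar> * t + B\<^sup>2 * t / 2) + exp (\<bar>B * \<theta>\<bar> * t + B\<^sup>2 * t / 2))"
  have bound: "integrable ?Q (X s)" "(LINT \<omega>|?Q. \<bar>X s \<omega>\<bar>) \<le> K" if s: "0 < s" "s \<le> t" for s
  proof -
    let ?dom = "\<lambda>\<omega>. A * (exp (B * W s \<omega>) + exp (- B * W s \<omega>))"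
    let ?e = "\<lambda>B. exp (B * (\<theta> * s) + B\<^sup>2 * s / 2)"
    have dom: "has_bochner_integral ?Q ?dom (A * (?e B + ?e (- B)))"
      by (intro has_bochner_integral_mult_right has_bochner_integral_add girsanov_exp_moment[OF F W s])
    then have int: "integrable ?Q ?dom" by (simp add: has_bochner_integral_iff)
    show XI: "integrable ?Q (X s)"
      by (rule Bochner_Integration.integrable_bound[OF int Xm])
         (use growth[of s] s A in \<open>auto simp: X_def intro!: AE_I2 order.trans[OF _ abs_ge_self]\<close>)
    have "(LINT \<omega>|?Q. \<bar>X s \<omega>\<bar>) \<le> (LINT \<omega>|?Q. ?dom \<omega>)"
      by (rule integral_mono[OF integrable_abs[OF XI] int]) (use growth[of s] s in \<open>auto simp: X_def\<close>)
    also have "\<dots> = A * (?e B + ?e (- B))" using dom by (simp add: has_bochner_integral_iff)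
    also have "\<dots> \<le> K"
    proof -
      have "C * (\<theta> * s) + C\<^sup>2 * s / 2 \<le> \<bar>B * \<theta>\<bar> * t + B\<^sup>2 * t / 2"
        if "C = B \<or> C = - B" for C
      proof -
        have "C * (\<theta> * s) \<le> \<bar>C * (\<theta> * s)\<bar>" by simp
        also have "\<dots> = \<bar>B * \<theta>\<bar> * s" using that s by (auto simp: abs_mult)
        also have "\<dots> \<le> \<bar>B * \<theta>\<bar> * t" using s by (intro mult_left_mono) auto
        finally have "C * (\<theta> * s) \<le> \<bar>B * \<theta>\<bar> * t" .
        moreover have "C\<^sup>2 * s / 2 \<le> B\<^sup>2 * t / 2"
          using that s by (auto intro!: divide_right_mono mult_left_mono)
        ultimately show ?thesis by (rule add_mono)
      qed
      from this[of B] this[of "- B"] A show ?thesis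
        unfolding K_def by (intro mult_left_mono add_mono) auto
    qed
    finally show "(LINT \<omega>|?Q. \<bar>X s \<omega>\<bar>) \<le> K" .
  qed
  \<comment> \<open>At \<open>s = 0\<close> the law of \<open>W s\<close> has no density; this single time is negligible.\<close>
  have AE_pos: "AE s in lborel. (s::real) \<noteq> 0" by (rule AE_lborel_singleton)
  have int: "integrable (lborel \<Otimes>\<^sub>M ?Q) (case_prod f)"
  proof (rule P.Fubini_integrable[OF f])
    have "integrable lborel (\<lambda>s. indicator {0..t} s *\<^sub>R K)"
      using borel_integrable_atLeastAtMost'[of 0 t "\<lambda>_. K"] by (simp add: set_integrable_def)
    then show "integrable lborel (\<lambda>s. LINT \<omega>|?Q. norm (case (s, \<omega>) of (s, \<omega>) \<Rightarrow> f s \<omega>))"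
    proof (rule Bochner_Integration.integrable_bound)
      show "AE s in lborel. norm (LINT \<omega>|?Q. norm (case (s, \<omega>) of (s, \<omega>) \<Rightarrow> f s \<omega>))
          \<le> norm (indicator {0..t} s *\<^sub>R K)"
        using AE_pos
        by eventually_elim (use bound(2) in \<open>auto simp: f_def indicator_def intro: order.trans[OF _ abs_ge_self]\<close>)
    qed simp
    show "AE s in lborel. integrable ?Q (\<lambda>\<omega>. case (s, \<omega>) of (s, \<omega>) \<Rightarrow> f s \<omega>)"
      using AE_pos by eventually_elim (use bound(1) in \<open>auto simp: f_def indicator_def\<close>)
  qed
  have path: "(LINT s|lborel. f s \<omega>) = (LBINT s:{0..t}. g s (W s \<omega>))" for \<omega>
    unfolding set_lebesgue_integral_def f_def X_def
    by (intro Bochner_Integration.integral_cong refl) (auto simp: indicator_def)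
  have "(LINT \<omega>|?Q. LINT s|lborel. f s \<omega>) = (LINT s|lborel. LINT \<omega>|?Q. f s \<omega>)"
    by (rule P.Fubini_integral[OF int])
  also have "\<dots> = (LBINT s:{0..t}. m s)"
  proof -
    have ae: "AE s in lborel. (LINT \<omega>|?Q. f s \<omega>) = indicator {0..t} s *\<^sub>R m s"
      using AE_pos by eventually_elim (auto simp: f_def X_def indicator_def mean)
    have m_meas: "(\<lambda>s. indicator {0..t} s *\<^sub>R m s) \<in> borel_measurable lborel"
      using borel_integrable_atLeastAtMost'[OF m] unfolding set_integrable_def by (rule borel_measurable_integrable)
    show ?thesis
      unfolding set_lebesgue_integral_def
      by (rule integral_cong_AE[OF _ m_meas ae]) simp
  qed
  finally show ?thesis
    using P.integrable_snd[OF int] by (simp add: path has_bochner_integral_iff)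
qed

text \<open>
  The variational bound for the drifted measure, whose relative entropy is \<open>\<theta>\<^sup>2 * t / 2\<close>.
\<close>

lemma exp_primitive_lower_bound:
  fixes g :: "real \<Rightarrow> real \<Rightarrow> real"
  assumes F: "filtered_prob_space M F" and W: "brownian_motion M F W" and t: "0 < t"
    and g: "continuous_on UNIV (\<lambda>(s, x). g s x)"
    and growth: "\<And>s x. 0 \<le> s \<Longrightarrow> s \<le> t \<Longrightarrow> \<bar>g s x\<bar> \<le> A * (exp (B * x) + exp (- B * x))"
    and m: "continuous_on {0..t} m"
    and mean: "\<And>s. 0 < s \<Longrightarrow> s \<le> t \<Longrightarrow> (LINT \<omega>|girsanov M W \<theta> t. g s (W s \<omega>)) = m s"
  shows "ennreal (exp (a * (LBINT s:{0..t}. m s) + b - \<theta>\<^sup>2 * t / 2))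
           \<le> (\<integral>\<^sup>+\<omega>. ennreal (exp (a * (LBINT s:{0..t}. g s (W s \<omega>)) + b)) \<partial>M)"
proof -
  let ?Q = "girsanov M W \<theta> t" and ?L = "girsanov_log_density W \<theta> t"
  let ?Y = "\<lambda>\<omega>. a * (LBINT s:{0..t}. g s (W s \<omega>)) + b"
  interpret Q: prob_space ?Q by (rule prob_space_girsanov[OF F W t])
  have "has_bochner_integral ?Q (\<lambda>\<omega>. ?Y \<omega> - ?L \<omega>)
      (a * (LBINT s:{0..t}. m s) + b - (\<theta> * (\<theta> * t) - \<theta>\<^sup>2 * t / 2))"
    unfolding girsanov_log_density_def
    using girsanov_mean_primitive[OF F W t g growth m mean] girsanov_brownian_mean[OF F W t order.refl, of \<theta>]
    by (auto simp: has_bochner_integral_iff Q.prob_space)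
  then have 1: "integrable ?Q (\<lambda>\<omega>. ?Y \<omega> - ?L \<omega>)"
    and 2: "(LINT \<omega>|?Q. ?Y \<omega> - ?L \<omega>) = a * (LBINT s:{0..t}. m s) + b - \<theta>\<^sup>2 * t / 2"
    by (auto simp: has_bochner_integral_iff power2_eq_square)
  have X: "continuous_adapted M F (\<lambda>s \<omega>. g s (W s \<omega>))"
    by (rule continuous_adapted_compose[OF brownian_continuous_adapted[OF W] g])
  have [measurable]: "(\<lambda>\<omega>. LBINT s:{0..t}. g s (W s \<omega>)) \<in> borel_measurable M" "W t \<in> borel_measurable M"
    using adapted_measurable[OF F continuous_adapted_primitive[OF F X]] t
      adapted_measurable[OF F brownian_continuous_adapted[OF W]] by auto
  have "?L \<in> borel_measurable M" unfolding girsanov_log_density_def[abs_def] by measurable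
  then show ?thesis
    unfolding 2[symmetric] unfolding girsanov_def
    by (rule gibbs_variational_bound) (use 1 Q.prob_space_axioms in \<open>simp_all add: girsanov_def\<close>)
qed

section \<open>Growth of the exponential moments in the two models\<close>

text \<open>
  With a drift \<open>\<theta>\<close> proportional to \<open>t\<close>, the gain \<open>\<alpha> * \<sigma> * \<theta> * t\<^sup>2 / 2\<close> in the mean and the entropy
  \<open>\<theta>\<^sup>2 * t / 2\<close> are both cubic in \<open>t\<close>. For \<open>\<theta> = \<alpha> * \<sigma> * t / 2\<close> the gain is twice the entropy, and all
  other terms have degree at most 2.
\<close>

lemma drifted_bm_mean_exponent_eventually_nonneg:
  fixes \<alpha> \<sigma> \<mu> r b :: real
  assumes "0 < \<alpha>" "\<sigma> \<noteq> 0"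
  shows "\<forall>\<^sub>F t in at_top. 0 \<le> \<alpha> * (r * t + (\<mu> + \<sigma> * (\<alpha> * \<sigma> * t / 2)) * t\<^sup>2 / 2) + b * t
            - (\<alpha> * \<sigma> * t / 2)\<^sup>2 * t / 2"
proof -
  define k where "k = \<alpha>\<^sup>2 * \<sigma>\<^sup>2 / 8"
  have k: "k > 0" using assms by (simp add: k_def)
  have "filterlim (\<lambda>t. (\<alpha> * r + b) * t + \<alpha> * \<mu> / 2 * t\<^sup>2 + k * t ^ 3) at_top at_top"
    using k by real_asymp
  then have "\<forall>\<^sub>F t in at_top. 0 \<le> (\<alpha> * r + b) * t + \<alpha> * \<mu> / 2 * t\<^sup>2 + k * t ^ 3"
    by (simp add: filterlim_at_top)
  moreover have "\<alpha> * (r * t + (\<mu> + \<sigma> * (\<alpha> * \<sigma> * t / 2)) * t\<^sup>2 / 2) + b * t - (\<alpha> * \<sigma> * t / 2)\<^sup>2 * t / 2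
      = (\<alpha> * r + b) * t + \<alpha> * \<mu> / 2 * t\<^sup>2 + k * t ^ 3" for t
    by (simp add: k_def field_simps power2_eq_square power3_eq_cube)
  ultimately show ?thesis by simp
qed

text \<open>
  Here the horizon \<open>t\<close> is fixed and \<open>x = \<mu> + \<sigma> * \<theta>\<close> is the growth rate of the mean interest rate: the
  gain is exponential in \<open>x\<close>, the entropy only quadratic.
\<close>

lemma geometric_bm_mean_exponent_eventually_nonneg:
  fixes \<alpha> \<sigma> \<mu> r b t :: real
  assumes "0 < \<alpha>" "\<sigma> \<noteq> 0" "0 < r" "0 < t"
  shows "\<forall>\<^sub>F x in at_top. 0 \<le> \<alpha> * (r * ((exp (x * t) - 1) / x)) + b - ((x - \<mu>) / \<sigma>)\<^sup>2 * t / 2"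
proof -
  define k where "k = \<sigma>\<^sup>2"
  have "k > 0" using assms by (simp add: k_def)
  with assms have "filterlim (\<lambda>x. \<alpha> * (r * ((exp (x * t) - 1) / x)) + b - (x - \<mu>)\<^sup>2 / k * t / 2) at_top at_top"
    by real_asymp
  then have "\<forall>\<^sub>F x in at_top. 0 \<le> \<alpha> * (r * ((exp (x * t) - 1) / x)) + b - (x - \<mu>)\<^sup>2 / k * t / 2"
    by (simp only: filterlim_at_top)
  then show ?thesis by (simp only: power_divide k_def)
qed

lemma drifted_bm_discounted_moment_ge_1:
  assumes F: "filtered_prob_space M F" and W: "brownian_motion M F W"
    and \<alpha>: "0 < \<alpha>" and \<sigma>: "\<sigma> \<noteq> 0"
  shows "\<forall>\<^sub>F t in at_top.
    1 \<le> (\<integral>\<^sup>+\<omega>. ennreal (exp (\<alpha> * (LBINT s:{0..t}. drifted_bm \<mu> \<sigma> W r s \<omega>) + b * t)) \<partial>M)"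
  using drifted_bm_mean_exponent_eventually_nonneg[OF \<alpha> \<sigma>, of r \<mu> b] eventually_gt_at_top[of 0]
proof eventually_elim
  case (elim t)
  then have t: "0 < t" by simp
  \<comment> \<open>This drift maximizes the exponent \<open>\<alpha> * \<sigma> * \<theta> * t\<^sup>2 / 2 - \<theta>\<^sup>2 * t / 2\<close>.\<close>
  define \<theta> where "\<theta> = \<alpha> * \<sigma> * t / 2"
  have growth: "\<bar>r + \<mu> * s + \<sigma> * x\<bar>
      \<le> (\<bar>r\<bar> + \<bar>\<mu>\<bar> * t + \<bar>\<sigma>\<bar>) * (exp (1 * x) + exp (- 1 * x))" if s: "0 \<le> s" "s \<le> t" for s x
  proof -
    have e: "1 + \<bar>x\<bar> \<le> exp x + exp (- x)"
      using exp_ge_add_one_self[of x] exp_ge_add_one_self[of "- x"] exp_gt_zero[of x] exp_gt_zero[of "- x"]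
      by linarith
    have "\<bar>r + \<mu> * s + \<sigma> * x\<bar> \<le> \<bar>r\<bar> + \<bar>\<mu>\<bar> * s + \<bar>\<sigma>\<bar> * \<bar>x\<bar>"
      using s by (intro order.trans[OF abs_triangle_ineq] add_mono) (auto simp: abs_mult)
    also have "\<dots> \<le> (\<bar>r\<bar> + \<bar>\<mu>\<bar> * t + \<bar>\<sigma>\<bar>) * (1 + \<bar>x\<bar>)"
    proof -
      have "\<bar>\<mu>\<bar> * s \<le> \<bar>\<mu>\<bar> * t" using s by (intro mult_left_mono) auto
      moreover have "0 \<le> \<bar>r\<bar> * \<bar>x\<bar>" "0 \<le> \<bar>\<mu>\<bar> * t * \<bar>x\<bar>" using t by simp_all
      ultimately show ?thesis by (simp only: distrib_left distrib_right mult_1_right) linarith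
    qed
    also have "\<dots> \<le> (\<bar>r\<bar> + \<bar>\<mu>\<bar> * t + \<bar>\<sigma>\<bar>) * (exp x + exp (- x))"
      using t e by (intro mult_left_mono) auto
    finally show ?thesis by simp
  qed
  have mean: "(LINT \<omega>|girsanov M W \<theta> t. r + \<mu> * s + \<sigma> * W s \<omega>) = r + (\<mu> + \<sigma> * \<theta>) * s"
    if s: "0 < s" "s \<le> t" for s
  proof -
    interpret Q: prob_space "girsanov M W \<theta> t" by (rule prob_space_girsanov[OF F W t])
    show ?thesis
      using girsanov_brownian_mean[OF F W s, of \<theta>]
      by (simp add: has_bochner_integral_iff Q.prob_space algebra_simps)
  qed
  have "ennreal (exp (\<alpha> * (LBINT s:{0..t}. r + (\<mu> + \<sigma> * \<theta>) * s) + b * t - \<theta>\<^sup>2 * t / 2))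
      \<le> (\<integral>\<^sup>+\<omega>. ennreal (exp (\<alpha> * (LBINT s:{0..t}. r + \<mu> * s + \<sigma> * W s \<omega>) + b * t)) \<partial>M)"
    by (rule exp_primitive_lower_bound[OF F W t _ growth _ mean])
       (auto intro!: continuous_intros simp: case_prod_beta)
  moreover have "1 \<le> ennreal (exp (\<alpha> * (LBINT s:{0..t}. r + (\<mu> + \<sigma> * \<theta>) * s) + b * t - \<theta>\<^sup>2 * t / 2))"
    using elim(1) t by (subst primitive_linear) (auto simp: \<theta>_def[symmetric])
  ultimately show ?case unfolding drifted_bm_def by (rule order.trans[rotated])
qed

text \<open>
  The argument works for every lower bound in place of 1, so these moments are in fact infinite.
\<close>

lemma geometric_bm_discounted_moment_ge_1:
  assumes F: "filtered_prob_space M F" and W: "brownian_motion M F W"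
    and \<alpha>: "0 < \<alpha>" and \<sigma>: "\<sigma> \<noteq> 0" and r: "0 < r" and t: "0 < t"
  shows "1 \<le> (\<integral>\<^sup>+\<omega>. ennreal (exp (\<alpha> * (LBINT s:{0..t}. geometric_bm \<mu> \<sigma> W r s \<omega>) + b * t)) \<partial>M)"
proof -
  have "\<forall>\<^sub>F x in at_top. 0 < x \<and>
      0 \<le> \<alpha> * (r * ((exp (x * t) - 1) / x)) + b * t - ((x - \<mu>) / \<sigma>)\<^sup>2 * t / 2"
    using geometric_bm_mean_exponent_eventually_nonneg[OF \<alpha> \<sigma> r t] eventually_gt_at_top
    by (rule eventually_conj[rotated])
  then obtain x where x: "0 < x"
    "0 \<le> \<alpha> * (r * ((exp (x * t) - 1) / x)) + b * t - ((x - \<mu>) / \<sigma>)\<^sup>2 * t / 2"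
    by (auto simp: eventually_at_top_linorder)
  \<comment> \<open>Under this drift the mean rate at time \<open>s\<close> is \<open>r * exp (x * s)\<close>.\<close>
  define \<theta> where "\<theta> = (x - \<mu>) / \<sigma>"
  have \<theta>: "\<mu> + \<sigma> * \<theta> = x" using \<sigma> by (simp add: \<theta>_def)
  let ?g = "\<lambda>s x. r * exp ((\<mu> - \<sigma>\<^sup>2 / 2) * s + \<sigma> * x)"
  have growth: "\<bar>?g s y\<bar> \<le> r * exp (\<bar>\<mu> - \<sigma>\<^sup>2 / 2\<bar> * t) * (exp (\<sigma> * y) + exp (- \<sigma> * y))"
    if s: "0 \<le> s" "s \<le> t" for s y
  proof -
    have "(\<mu> - \<sigma>\<^sup>2 / 2) * s \<le> \<bar>\<mu> - \<sigma>\<^sup>2 / 2\<bar> * s"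
      using s by (intro mult_right_mono) auto
    also have "\<dots> \<le> \<bar>\<mu> - \<sigma>\<^sup>2 / 2\<bar> * t"
      using s by (intro mult_left_mono) auto
    finally have "(\<mu> - \<sigma>\<^sup>2 / 2) * s \<le> \<bar>\<mu> - \<sigma>\<^sup>2 / 2\<bar> * t" .
    then have "exp ((\<mu> - \<sigma>\<^sup>2 / 2) * s) * exp (\<sigma> * y)
        \<le> exp (\<bar>\<mu> - \<sigma>\<^sup>2 / 2\<bar> * t) * (exp (\<sigma> * y) + exp (- \<sigma> * y))"
      by (intro mult_mono) auto
    with r show ?thesis by (simp add: exp_add abs_mult)
  qed
  have mean: "(LINT \<omega>|girsanov M W \<theta> t. ?g s (W s \<omega>)) = r * exp (x * s)"
    if s: "0 < s" "s \<le> t" for s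
  proof -
    have "(\<mu> - \<sigma>\<^sup>2 / 2) * s + (\<sigma> * (\<theta> * s) + \<sigma>\<^sup>2 * s / 2) = x * s"
      unfolding \<theta>[symmetric] by (simp add: field_simps)
    then have "exp ((\<mu> - \<sigma>\<^sup>2 / 2) * s) * exp (\<sigma> * (\<theta> * s) + \<sigma>\<^sup>2 * s / 2) = exp (x * s)"
      unfolding exp_add[symmetric] by simp
    then show ?thesis
      using girsanov_exp_moment[OF F W s, of \<theta> \<sigma>]
      by (simp add: has_bochner_integral_iff exp_add[of "(\<mu> - \<sigma>\<^sup>2 / 2) * s"])
  qed
  have "ennreal (exp (\<alpha> * (LBINT s:{0..t}. r * exp (x * s)) + b * t - \<theta>\<^sup>2 * t / 2))
      \<le> (\<integral>\<^sup>+\<omega>. ennreal (exp (\<alpha> * (LBINT s:{0..t}. ?g s (W s \<omega>)) + b * t)) \<partial>M)"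
    by (rule exp_primitive_lower_bound[OF F W t _ growth _ mean])
       (auto intro!: continuous_intros simp: case_prod_beta)
  moreover have "1 \<le> ennreal (exp (\<alpha> * (LBINT s:{0..t}. r * exp (x * s)) + b * t - \<theta>\<^sup>2 * t / 2))"
    using x t by (subst primitive_exp) (auto simp: \<theta>_def)
  ultimately show ?thesis unfolding geometric_bm_def by (rule order.trans[rotated])
qed

section \<open>Divergence of the discounted growth and of the value function\<close>

lemma nn_integral_time_eq_top:
  assumes F: "filtered_prob_space M F" and X: "continuous_adapted M F X"
    and ge: "\<forall>\<^sub>F t in at_top. 1 \<le> (\<integral>\<^sup>+\<omega>. ennreal (exp (X t \<omega>)) \<partial>M)"
  shows "(\<integral>\<^sup>+\<omega>. (\<integral>\<^sup>+t\<in>{0..}. ennreal (exp (X t \<omega>)) \<partial>lborel) \<partial>M) = \<infinity>"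
proof -
  interpret prob_space M using F by (simp add: filtered_prob_space_def)
  interpret P: pair_sigma_finite lborel M by standard
  define f where "f t \<omega> = ennreal (exp (X (max 0 t) \<omega>)) * indicator {0..} t" for t \<omega>
  have sets_eq: "sets (lborel \<Otimes>\<^sub>M M) = sets (borel \<Otimes>\<^sub>M M)"
    by (rule sets_pair_measure_cong) simp_all
  have "(\<lambda>(t, \<omega>). X (max 0 t) \<omega>) \<in> borel_measurable (lborel \<Otimes>\<^sub>M M)"
    using joint_measurable[OF F X] unfolding measurable_cong_sets[OF sets_eq refl] .
  then have [measurable]: "(\<lambda>p. X (max 0 (fst p)) (snd p)) \<in> borel_measurable (lborel \<Otimes>\<^sub>M M)"
    by (simp add: case_prod_beta)
  have f: "case_prod f \<in> borel_measurable (lborel \<Otimes>\<^sub>M M)"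
    unfolding f_def case_prod_beta by measurable
  obtain T where T: "0 \<le> T" "\<And>t. T \<le> t \<Longrightarrow> 1 \<le> (\<integral>\<^sup>+\<omega>. ennreal (exp (X t \<omega>)) \<partial>M)"
  proof -
    from ge obtain T' where "\<And>t. T' \<le> t \<Longrightarrow> 1 \<le> (\<integral>\<^sup>+\<omega>. ennreal (exp (X t \<omega>)) \<partial>M)"
      by (auto simp: eventually_at_top_linorder)
    then show ?thesis by (intro that[of "max 0 T'"]) auto
  qed
  have "\<infinity> = emeasure lborel {T..}"
  proof -
    have "ennreal (real n) \<le> emeasure lborel {T..}" for n
      using emeasure_mono[of "{T..T + real n}" "{T..}" lborel] by auto
    then show ?thesis
      by (metis ennreal_of_nat_eq_real_of_nat ennreal_Ex_less_of_nat infinity_ennreal_def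
          leD less_top)
  qed
  also have "\<dots> = (\<integral>\<^sup>+t. indicator {T..} t \<partial>lborel)" by simp
  also have "\<dots> \<le> (\<integral>\<^sup>+t. \<integral>\<^sup>+\<omega>. f t \<omega> \<partial>M \<partial>lborel)"
    using T by (intro nn_integral_mono) (auto simp: indicator_def f_def max_def)
  also have "\<dots> = (\<integral>\<^sup>+\<omega>. \<integral>\<^sup>+t. f t \<omega> \<partial>lborel \<partial>M)"
    by (rule P.Fubini'[OF f, symmetric])
  also have "\<dots> = (\<integral>\<^sup>+\<omega>. (\<integral>\<^sup>+t\<in>{0..}. ennreal (exp (X t \<omega>)) \<partial>lborel) \<partial>M)"
    by (intro nn_integral_cong) (auto simp: f_def indicator_def)
  finally show ?thesis by (simp add: top_unique)
qed

text \<open>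
  Discounting and the constant \<open>c\<close> change the exponent only by a term linear in \<open>t\<close>, which the
  hypothesis absorbs in \<open>b\<close>.
\<close>

lemma discounted_growth_eq_top:
  assumes F: "filtered_prob_space M F" and X: "continuous_adapted M F X"
    and ge: "\<And>b. \<forall>\<^sub>F t in at_top.
      1 \<le> (\<integral>\<^sup>+\<omega>. ennreal (exp (\<alpha> * (LBINT s:{0..t}. X s \<omega>) + b * t)) \<partial>M)"
  shows "(\<integral>\<^sup>+\<omega>. (\<integral>\<^sup>+t\<in>{0..}. ennreal (exp (- \<gamma> * t + \<alpha> * (LBINT s:{0..t}. X s \<omega> - c))) \<partial>lborel) \<partial>M) = \<infinity>"
proof -
  let ?Z = "\<lambda>t \<omega>. \<alpha> * (LBINT s:{0..t}. X s \<omega>) + (- \<gamma> - \<alpha> * c) * t"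
  have "continuous_adapted M F ?Z"
    by (rule continuous_adapted_compose[OF continuous_adapted_primitive[OF F X],
          where g = "\<lambda>t x. \<alpha> * x + (- \<gamma> - \<alpha> * c) * t"])
       (auto intro!: continuous_intros simp: case_prod_beta)
  from nn_integral_time_eq_top[OF F this ge]
  have "\<infinity> = (\<integral>\<^sup>+\<omega>. (\<integral>\<^sup>+t\<in>{0..}. ennreal (exp (?Z t \<omega>)) \<partial>lborel) \<partial>M)" by simp
  also have "\<dots> = (\<integral>\<^sup>+\<omega>. (\<integral>\<^sup>+t\<in>{0..}. ennreal (exp (- \<gamma> * t + \<alpha> * (LBINT s:{0..t}. X s \<omega> - c))) \<partial>lborel) \<partial>M)"
  proof (intro nn_integral_cong)
    fix \<omega> t assume \<omega>: "\<omega> \<in> space M"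
    show "ennreal (exp (?Z t \<omega>)) * indicator {0..} t
        = ennreal (exp (- \<gamma> * t + \<alpha> * (LBINT s:{0..t}. X s \<omega> - c))) * indicator {0..} t"
    proof (cases "0 \<le> t")
      case True
      with X \<omega> have cont: "continuous_on {0..t} (\<lambda>s. X s \<omega>)"
        by (auto simp: continuous_adapted_def intro: continuous_on_subset)
      show ?thesis unfolding primitive_diff_const[OF True cont] by (simp add: algebra_simps)
    qed simp
  qed
  finally show ?thesis by simp
qed

lemma proportional_control_admissible:
  assumes F: "filtered_prob_space M F" and X: "continuous_adapted M F X" and cv: "0 \<le> c" "0 \<le> v"
  shows "(\<lambda>t \<omega>. c * (v * exp (LBINT s:{0..t}. X s \<omega> - c))) \<in> controls M F"
proof -
  have "continuous_adapted M F (\<lambda>t \<omega>. X t \<omega> - c)"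
    by (rule continuous_adapted_compose[OF X, of "\<lambda>_ x. x - c"])
       (auto intro!: continuous_intros simp: case_prod_beta)
  then have "continuous_adapted M F (\<lambda>t \<omega>. LBINT s:{0..t}. X s \<omega> - c)"
    by (rule continuous_adapted_primitive[OF F])
  then have "continuous_adapted M F (\<lambda>t \<omega>. c * (v * exp (LBINT s:{0..t}. X s \<omega> - c)))"
    by (rule continuous_adapted_compose[where g = "\<lambda>_ x. c * (v * exp x)"])
       (auto intro!: continuous_intros simp: case_prod_beta)
  from continuous_adapted_progressively_measurable[OF F this] cv show ?thesis
    by (simp add: controls_def)
qed

lemma value_A_ge_proportional:
  assumes F: "filtered_prob_space M F" and X: "continuous_adapted M F X" and v: "0 < v"
  shows "(\<integral>\<^sup>+\<omega>. (\<integral>\<^sup>+t\<in>{0..}. ennreal (exp (- \<gamma> * t + \<alpha> * (LBINT s:{0..t}. X s \<omega> - 1 / v))) \<partial>lborel) \<partial>M)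
           \<le> value_A M F \<gamma> \<alpha> X v"
proof -
  \<comment> \<open>With the rate \<open>1 / v\<close> the initial wealth cancels and the payoff is exactly the left-hand side.\<close>
  let ?C = "\<lambda>t \<omega>. 1 / v * (v * exp (LBINT s:{0..t}. X s \<omega> - 1 / v))"
  have "(\<integral>\<^sup>+\<omega>. (\<integral>\<^sup>+t\<in>{0..}. ennreal (exp (- \<gamma> * t + \<alpha> * (LBINT s:{0..t}. X s \<omega> - 1 / v))) \<partial>lborel) \<partial>M)
      = payoff_A M \<gamma> \<alpha> X ?C v"
    unfolding payoff_A_def
  proof (intro nn_integral_cong)
    fix \<omega> t assume "\<omega> \<in> space M"
    with X have cont: "continuous_on {0..} (\<lambda>s. X s \<omega>)" by (simp add: continuous_adapted_def)
    have "{t. 0 \<le> t \<and> ennreal t < ruin_time (\<lambda>s. X s \<omega>) (\<lambda>s. ?C s \<omega>) v} = {0..}"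
      unfolding ruin_time_proportional[OF v cont] by (auto simp: less_top[symmetric])
    moreover have "exp (- \<gamma> * t) * ?C t \<omega> powr \<alpha> = exp (- \<gamma> * t + \<alpha> * (LBINT s:{0..t}. X s \<omega> - 1 / v))"
      using v by (simp add: powr_def flip: exp_add)
    ultimately show "ennreal (exp (- \<gamma> * t + \<alpha> * (LBINT s:{0..t}. X s \<omega> - 1 / v))) * indicator {0..} t
        = ennreal (exp (- \<gamma> * t) * ?C t \<omega> powr \<alpha>)
          * indicator {t. 0 \<le> t \<and> ennreal t < ruin_time (\<lambda>s. X s \<omega>) (\<lambda>s. ?C s \<omega>) v} t"
      by (simp only:)
  qed
  also have "\<dots> \<le> value_A M F \<gamma> \<alpha> X v"
    unfolding value_A_def using v by (intro SUP_upper proportional_control_admissible[OF F X]) auto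
  finally show ?thesis .
qed

theorem proposition5:
  fixes M :: "'a measure" and F :: "real \<Rightarrow> 'a measure"
    and W :: "real \<Rightarrow> 'a \<Rightarrow> real" and R :: "real \<Rightarrow> real \<Rightarrow> 'a \<Rightarrow> real"
    and D :: "real set" and \<gamma> \<alpha> \<mu> \<sigma> :: real
  assumes "filtered_prob_space M F"
    and "brownian_motion M F W"
    and "\<gamma> \<ge> 0" and "0 < \<alpha>" and "\<alpha> < 1" and "\<sigma> \<noteq> 0"
    and "(R = drifted_bm \<mu> \<sigma> W \<and> D = UNIV) \<or> (R = geometric_bm \<mu> \<sigma> W \<and> D = {0<..})"
  shows "(\<forall>c>0. \<forall>r\<in>D.
            \<not> (\<integral>\<^sup>+\<omega>. (\<integral>\<^sup>+t\<in>{0..}.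
                  ennreal (exp (- \<gamma> * t + \<alpha> * (LBINT s:{0..t}. R r s \<omega> - c))) \<partial>lborel) \<partial>M) < \<infinity>)
       \<and> (\<forall>r\<in>D. \<forall>v>0. value_A M F \<gamma> \<alpha> (R r) v = \<infinity>)"
proof -
  note F = assms(1) and W = assms(2) and \<alpha> = assms(4) and \<sigma> = assms(6)
  have adapted: "continuous_adapted M F (R r)" for r
  proof -
    have "continuous_adapted M F (\<lambda>t \<omega>. r + \<mu> * t + \<sigma> * W t \<omega>)"
      by (rule continuous_adapted_compose[OF brownian_continuous_adapted[OF W],
            where g = "\<lambda>t x. r + \<mu> * t + \<sigma> * x"])
         (auto intro!: continuous_intros simp: case_prod_beta)
    moreover have "continuous_adapted M F (\<lambda>t \<omega>. r * exp ((\<mu> - \<sigma>\<^sup>2 / 2) * t + \<sigma> * W t \<omega>))"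
      by (rule continuous_adapted_compose[OF brownian_continuous_adapted[OF W],
            where g = "\<lambda>t x. r * exp ((\<mu> - \<sigma>\<^sup>2 / 2) * t + \<sigma> * x)"])
         (auto intro!: continuous_intros simp: case_prod_beta)
    ultimately show ?thesis
      using assms(7) by (auto simp: drifted_bm_def[abs_def] geometric_bm_def[abs_def])
  qed
  have ge: "\<forall>\<^sub>F t in at_top.
      1 \<le> (\<integral>\<^sup>+\<omega>. ennreal (exp (\<alpha> * (LBINT s:{0..t}. R r s \<omega>) + b * t)) \<partial>M)" if "r \<in> D" for r b
    using assms(7)
  proof
    assume "R = drifted_bm \<mu> \<sigma> W \<and> D = UNIV"
    then show ?thesis using drifted_bm_discounted_moment_ge_1[OF F W \<alpha> \<sigma>] by simp
  next
    assume "R = geometric_bm \<mu> \<sigma> W \<and> D = {0<..}"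
    with that show ?thesis
      using geometric_bm_discounted_moment_ge_1[OF F W \<alpha> \<sigma>]
      by (auto intro: eventually_mono[OF eventually_gt_at_top[of 0]])
  qed
  have top: "(\<integral>\<^sup>+\<omega>. (\<integral>\<^sup>+t\<in>{0..}.
      ennreal (exp (- \<gamma> * t + \<alpha> * (LBINT s:{0..t}. R r s \<omega> - c))) \<partial>lborel) \<partial>M) = \<infinity>"
    if "r \<in> D" for r c
    by (rule discounted_growth_eq_top[OF F adapted ge[OF that]])
  have "value_A M F \<gamma> \<alpha> (R r) v = \<infinity>" if "r \<in> D" "0 < v" for r v
    using value_A_ge_proportional[OF F adapted that(2), of \<gamma> \<alpha> r] top[OF that(1), of "1 / v"]
    by (simp add: top_unique)
  with top show ?thesis by simp
qed

end
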